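(* Let $(\mathbb{C}^r/G,[\mathbf{0}])$ be a Gorenstein abelian quotient singularity, i.e. $G$ is a finite abelian subgroup of $\mathrm{SL}(r,\mathbb{C})$ acting by diagonal matrices. If the junior simplex $\mathfrak{s}_G$ has a basic triangulation (with respect to $N_G$), then $$\mathbf{Hlb}_{N_G}(\sigma_0)=\mathfrak{s}_G\cap N_G .$$
   Context: Let $r\ge 2$ and let $G\subset\mathrm{SL}(r,\mathbb{C})$ be a finite abelian group, with coordinates of $\mathbb{C}^r$ chosen so that $G$ consists of diagonal matrices. $N_G:=\{(y_1,\ldots,y_r)^{\intercal}\in\mathbb{R}^r : \mathrm{diag}(e^{2\pi\sqrt{-1}y_1},\ldots,e^{2\pi\sqrt{-1}y_r})\in G\}$ is a lattice in $\mathbb{R}^r$ containing $\mathbb{Z}^r$. Let $e_1,\ldots,e_r$ be the standard basis of $\mathbb{R}^r$, $\sigma_0:=\mathbb{R}_{\ge 0}e_1+\cdots+\mathbb{R}_{\geq 0}e_r$ the positive orthant, and $\mathfrak{s}_G:=\mathrm{conv}(\{e_1,\ldots,e_r\})$ the junior simplex. The Hilbert basis $\mathbf{Hlb}_{N_G}(\sigma_0)$ is the set of all $n\in\sigma_0\cap(N_G\smallsetminus\{\mathbf{0}\})$ which cannot be expressed as a sum of two vectors belonging to $\sigma_0\cap(N_G\smallsetminus\{\mathbf{0}\})$; it is the unique minimal generating system of the additive monoid $\sigma_0\cap N_G$. A lattice triangulation of $\mathfrak{s}_G$ is a (geometric) triangulation of $\mathfrak{s}_G$ all of whose vertices lie in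 $N_G$. A lattice simplex is basic w.r.t. $N_G$ if its vertices constitute a part of a $\mathbb{Z}$-basis of $N_G$; a lattice triangulation is basic if all of its simplices are basic. *)

theory Defs
  imports "HOL-Analysis.Analysis" "HOL-Algebra.Group"
begin

definition SL :: "('a::comm_ring_1 ^ 'n ^ 'n) monoid" where
  "SL = \<lparr>carrier = {A. det A = 1}, monoid.mult = (**), one = mat 1\<rparr>"

lemma group_SL: "group (SL :: ('a::field ^ 'n ^ 'n) monoid)"
proof (rule groupI)
  fix A :: "'a ^ 'n ^ 'n"
  assume "A \<in> carrier SL"
  then have d: "det A = 1" by (simp add: SL_def)
  then have "invertible A" by (simp add: invertible_det_nz)
  then obtain B where B: "B ** A = mat 1" by (auto simp: invertible_def)
  have "det B * det A = 1" using det_mul[of B A] B by simp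
  then have "det B = 1" using d by simp
  then show "\<exists>B\<in>carrier SL. B \<otimes>\<^bsub>SL\<^esub> A = \<one>\<^bsub>SL\<^esub>" using B by (auto simp: SL_def)
qed (auto simp: SL_def det_mul matrix_mul_assoc)

definition diag :: "'a::zero ^ 'n \<Rightarrow> 'a ^ 'n ^ 'n" where
  "diag d = (\<chi> i j. if i = j then d $ i else 0)"

definition lattice_of :: "(complex ^ 'n ^ 'n) set \<Rightarrow> (real ^ 'n) set" where
  "lattice_of G = {y. diag (\<chi> i. exp (2 * of_real pi * \<i> * of_real (y $ i))) \<in> G}"

definition positive_orthant :: "(real ^ 'n) set" where
  "positive_orthant = {\<Sum>i\<in>UNIV. c i *\<^sub>R axis i 1 | c. \<forall>i. 0 \<le> c i}"

definition junior_simplex :: "(real ^ 'n) set" where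
  "junior_simplex = convex hull (range (\<lambda>i. axis i 1))"

definition hilbert_basis :: "'a::real_vector set \<Rightarrow> 'a set \<Rightarrow> 'a set" where
  "hilbert_basis N \<sigma> = {n \<in> \<sigma> \<inter> (N - {0}).
     \<not> (\<exists>a \<in> \<sigma> \<inter> (N - {0}). \<exists>b \<in> \<sigma> \<inter> (N - {0}). n = a + b)}"

text \<open>Real vectors as a module over the integers, so that the generic notions of span and
  linear dependence from \<^theory>\<open>HOL.Modules\<close> are taken with integer coefficients.\<close>

abbreviation int_scale :: "int \<Rightarrow> 'a::real_vector \<Rightarrow> 'a" where
  "int_scale k x \<equiv> of_int k *\<^sub>R x"

lemma module_int_scale: "module (int_scale :: int \<Rightarrow> 'a::real_vector \<Rightarrow> 'a)"
  by (simp add: module_def scaleR_add_left scaleR_add_right)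

definition int_basis :: "'a::real_vector set \<Rightarrow> 'a set \<Rightarrow> bool" where
  "int_basis B N \<longleftrightarrow> \<not> module.dependent int_scale B \<and> module.span int_scale B = N"

definition vertices :: "'a::real_vector set \<Rightarrow> 'a set" where
  "vertices S = {v. v extreme_point_of S}"

definition basic_simplex :: "'a::euclidean_space set \<Rightarrow> 'a set \<Rightarrow> bool" where
  "basic_simplex N S \<longleftrightarrow> (\<exists>n. n simplex S) \<and> (\<exists>B. int_basis B N \<and> vertices S \<subseteq> B)"

text \<open>Triangulations are understood as geometric simplicial complexes, hence closed under
  taking faces; the predicate \<^const>\<open>triangulation\<close> does not require this. As usual in the
  library, the empty set counts as a simplex (of dimension $-1$).\<close>

definition lattice_triangulation :: "'a::euclidean_space set \<Rightarrow> 'a set \<Rightarrow> 'a set set \<Rightarrow> bool" where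
  "lattice_triangulation N P \<T> \<longleftrightarrow>
     simplicial_complex \<T> \<and> \<Union>\<T> = P \<and> (\<forall>S\<in>\<T>. vertices S \<subseteq> N)"

definition basic_triangulation :: "'a::euclidean_space set \<Rightarrow> 'a set \<Rightarrow> 'a set set \<Rightarrow> bool" where
  "basic_triangulation N P \<T> \<longleftrightarrow>
     lattice_triangulation N P \<T> \<and> (\<forall>S\<in>\<T>. basic_simplex N S)"

end

theory Submission
  imports Defs
begin

text \<open>Every vector of the lattice has integral coordinate sum, because the group lies in
  \<open>SL\<close>; hence a lattice point of the junior simplex cannot be split in the orthant.
  Conversely, scale a nonzero lattice point \<open>n\<close> of the orthant into the junior simplex and pick
  the simplex of the triangulation containing it. Basicness makes the cone coefficients
  of \<open>n\<close> nonnegative integers, so some vertex \<open>v\<close> can be split off: \<open>n = v + (n - v)\<close>. If \<open>n\<close> is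
  in the Hilbert basis, this forces \<open>n = v\<close>.

  An integral basis is by definition only independent over the integers; independence over the
  reals holds because lattice vectors have rational coordinates, the group being finite.\<close>

section \<open>From integral to real linear independence\<close>

lemma int_common_denominator:
  assumes "finite F"
  shows "\<exists>d::int. d \<noteq> 0 \<and> (\<forall>b\<in>F. \<exists>k::int. of_int d * (q b :: rat) = of_int k)"
  using assms
proof (induction F)
  case empty
  show ?case by (rule exI[of _ 1]) simp
next
  case (insert x F)
  then obtain d :: int where d: "d \<noteq> 0" "\<forall>b\<in>F. \<exists>k::int. of_int d * q b = of_int k" by blast
  obtain a b where ab: "quotient_of (q x) = (a, b)" by fastforce
  have b: "b > 0" and qx: "q x = of_int a / of_int b"
    using quotient_of_denom_pos[OF ab] quotient_of_div[OF ab] by auto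
  have "\<exists>k::int. of_int (d * b) * q y = of_int k" if y: "y \<in> insert x F" for y
  proof (cases "y = x")
    case True
    then show ?thesis using b qx by (intro exI[of _ "d * a"]) simp
  next
    case False
    then obtain k :: int where "of_int d * q y = of_int k" using d y by auto
    then show ?thesis by (intro exI[of _ "b * k"]) (simp add: ac_simps)
  qed
  then show ?case using d b by (intro exI[of _ "d * b"]) auto
qed

text \<open>A nonzero real is an independent singleton over the rationals, so the assignment of 1 to
  it extends to a rational-linear map on all of the reals.\<close>

lemma exists_rat_linear_functional:
  fixes x :: real
  assumes "x \<noteq> 0"
  obtains f :: "real \<Rightarrow> rat"
  where "Modules.additive f" "\<And>q r. f (of_rat q * r) = q * f r" "f x = 1"
proof -
  have V: "vector_space (\<lambda>q (r::real). of_rat q * r)"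
    by unfold_locales (auto simp: algebra_simps of_rat_add of_rat_mult)
  have W: "vector_space (\<lambda>q (r::rat). q * r)"
    by unfold_locales (auto simp: algebra_simps)
  interpret V: vector_space_pair "\<lambda>q (r::real). of_rat q * r" "\<lambda>q (r::rat). q * r"
    using V W by (simp add: vector_space_pair_def)
  have "V.vs1.independent {x}" using assms by simp
  then obtain f where f: "Vector_Spaces.linear (\<lambda>q (r::real). of_rat q * r) (\<lambda>q (r::rat). q * r) f"
    and "f x = 1"
    using V.linear_independent_extend[of "{x}" "\<lambda>_. 1"] by auto
  then show thesis
    using that[of f] V.linear_add[OF f] V.linear_scale[OF f] by (simp add: Modules.additive_def)
qed

text \<open>A real relation is turned into a rational one by applying a \<open>\<rat>\<close>-linear functional
  \<open>\<real> \<rightarrow> \<rat>\<close> to its coefficients.\<close>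

lemma independent_if_int_independent:
  fixes B :: "(real ^ 'n) set"
  assumes rat: "\<And>b i. b \<in> B \<Longrightarrow> b $ i \<in> \<rat>"
    and ind: "\<not> module.dependent int_scale B"
  shows "independent B"
proof
  assume "dependent B"
  then obtain F u b0 where F: "finite F" "F \<subseteq> B" and u: "(\<Sum>b\<in>F. u b *\<^sub>R b) = 0"
    and b0: "b0 \<in> F" "u b0 \<noteq> 0"
    unfolding real_vector.dependent_explicit by auto
  obtain f :: "real \<Rightarrow> rat" where f: "Modules.additive f" "\<And>q r. f (of_rat q * r) = q * f r"
    and f1: "f (u b0) = 1"
    using exists_rat_linear_functional[OF b0(2)] by blast
  \<comment> \<open>In each coordinate the entries of the \<open>b\<close> are rational scalars, so
    \<open>f\<close> passes through the sum and acts on the coefficients \<open>u b\<close>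
    alone.\<close>
  have "(\<Sum>b\<in>F. of_rat (f (u b)) * b $ i) = 0" for i
  proof -
    have "\<exists>q. b $ i = of_rat q" if "b \<in> F" for b
      using rat[of b i] F(2) that by (auto elim: Rats_cases)
    then obtain q where q: "\<And>b. b \<in> F \<Longrightarrow> b $ i = of_rat (q b)" by metis
    have "(\<Sum>b\<in>F. u b * b $ i) = 0"
      using arg_cong[OF u, of "\<lambda>v. v $ i"] by simp
    then have "f (\<Sum>b\<in>F. of_rat (q b) * u b) = 0"
      using Modules.additive.zero[OF f(1)] q by (simp add: mult.commute cong: sum.cong)
    then have "(\<Sum>b\<in>F. q b * f (u b)) = 0"
      by (simp add: Modules.additive.sum[OF f(1)] f(2))
    then have "(of_rat (\<Sum>b\<in>F. q b * f (u b)) :: real) = 0" by simp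
    then show ?thesis
      using q by (simp add: of_rat_sum of_rat_mult mult.commute cong: sum.cong)
  qed
  then have R: "(\<Sum>b\<in>F. of_rat (f (u b)) *\<^sub>R b) = 0"
    by (simp add: vec_eq_iff)
  \<comment> \<open>Clearing denominators makes the rational relation integral. It stays nontrivial:
    \<open>f (u b0) = 1\<close>, so the coefficient of \<open>b0\<close> becomes
    \<open>d\<close>.\<close>
  obtain d :: int where d: "d \<noteq> 0" "\<forall>b\<in>F. \<exists>k::int. of_int d * f (u b) = of_int k"
    using int_common_denominator[OF F(1), of "\<lambda>b. f (u b)"] by metis
  then obtain k :: "real ^ 'n \<Rightarrow> int" where k: "\<And>b. b \<in> F \<Longrightarrow> of_int d * f (u b) = of_int (k b)"
    by metis
  have k': "real_of_int (k b) = of_int d * of_rat (f (u b))" if "b \<in> F" for b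
    using arg_cong[OF k[OF that], of "of_rat :: rat \<Rightarrow> real"] by (simp add: of_rat_mult)
  have "(\<Sum>b\<in>F. int_scale (k b) b) = of_int d *\<^sub>R (\<Sum>b\<in>F. of_rat (f (u b)) *\<^sub>R b)"
    by (simp add: scaleR_sum_right k' cong: sum.cong)
  then have "(\<Sum>b\<in>F. int_scale (k b) b) = 0" using R by simp
  moreover have "k b0 \<noteq> 0" using k[OF b0(1)] d f1 by auto
  ultimately have "module.dependent int_scale B"
    unfolding module.dependent_explicit[OF module_int_scale] using F b0 by blast
  then show False using ind by simp
qed

text \<open>A lattice vector also has an expansion over \<open>B\<close> with integer coefficients;
  by real independence the given real expansion must coincide with it.\<close>

lemma int_coefficients_if_int_basis:
  fixes B :: "'a::real_vector set"
  assumes B: "int_basis B N" and ind: "independent B"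
    and C: "finite C" "C \<subseteq> B" and n: "(\<Sum>v\<in>C. c v *\<^sub>R v) \<in> N" and v: "v \<in> C"
  shows "c v \<in> \<int>"
proof -
  have "(\<Sum>v\<in>C. c v *\<^sub>R v) \<in> module.span int_scale B"
    using n B by (simp add: int_basis_def)
  then obtain F k where F: "finite F" "F \<subseteq> B"
    and eq: "(\<Sum>v\<in>C. c v *\<^sub>R v) = (\<Sum>b\<in>F. int_scale (k b) b)"
    unfolding module.span_explicit[OF module_int_scale] by auto
  \<comment> \<open>Both coefficient families are padded by 0, so that the two expansions can be
    subtracted over the common support \<open>C \<union> F\<close>.\<close>
  define c' where "c' b = (if b \<in> C then c b else 0)" for b
  define k' where "k' b = (if b \<in> F then real_of_int (k b) else 0)" for b
  have "(\<Sum>b\<in>C \<union> F. c' b *\<^sub>R b) = (\<Sum>v\<in>C. c v *\<^sub>R v)"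
    by (rule sum.mono_neutral_cong_right) (use C F in \<open>auto simp: c'_def\<close>)
  moreover have "(\<Sum>b\<in>C \<union> F. k' b *\<^sub>R b) = (\<Sum>b\<in>F. int_scale (k b) b)"
    by (rule sum.mono_neutral_cong_right) (use C F in \<open>auto simp: k'_def\<close>)
  ultimately have "(\<Sum>b\<in>C \<union> F. (c' b - k' b) *\<^sub>R b) = 0"
    using eq by (simp add: scaleR_diff_left sum_subtractf)
  then have "c' v - k' v = 0"
    using real_vector.independentD[OF ind, of "C \<union> F" "\<lambda>b. c' b - k' b"] C F v by auto
  then show ?thesis using v by (auto simp: c'_def k'_def split: if_splits)
qed

section \<open>Coordinate descriptions of the orthant and the junior simplex\<close>

lemma positive_orthant_eq: "positive_orthant = {y :: real ^ 'n. \<forall>i. 0 \<le> y $ i}"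
proof -
  have *: "(\<Sum>i\<in>UNIV. c i *\<^sub>R axis i 1) = (\<chi> i. c i)" for c :: "'n \<Rightarrow> real"
    by (simp add: vec_eq_iff axis_def if_distrib cong: if_cong)
  show ?thesis unfolding positive_orthant_def *
  proof (intro Set.set_eqI iffI)
    fix y :: "real ^ 'n" assume "y \<in> {y. \<forall>i. 0 \<le> y $ i}"
    then show "y \<in> {\<chi> i. c i | c. \<forall>i. 0 \<le> c i}"
      by (auto intro!: exI[of _ "\<lambda>i. y $ i"])
  qed auto
qed

lemma junior_simplex_eq:
  "junior_simplex = {y :: real ^ 'n. (\<forall>i. 0 \<le> y $ i) \<and> (\<Sum>i\<in>UNIV. y $ i) = 1}"
proof
  show "junior_simplex \<subseteq> {y :: real ^ 'n. (\<forall>i. 0 \<le> y $ i) \<and> (\<Sum>i\<in>UNIV. y $ i) = 1}"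
    unfolding junior_simplex_def
  proof (rule hull_minimal)
    show "convex {y :: real ^ 'n. (\<forall>i. 0 \<le> y $ i) \<and> (\<Sum>i\<in>UNIV. y $ i) = 1}"
      by (auto simp: convex_def sum.distrib simp flip: sum_distrib_left)
  qed (auto simp: axis_def)
next
  show "{y :: real ^ 'n. (\<forall>i. 0 \<le> y $ i) \<and> (\<Sum>i\<in>UNIV. y $ i) = 1} \<subseteq> junior_simplex"
  proof clarify
    fix y :: "real ^ 'n" assume y: "\<forall>i. 0 \<le> y $ i" "(\<Sum>i\<in>UNIV. y $ i) = 1"
    have "(\<Sum>i\<in>UNIV. y $ i *\<^sub>R axis i 1) \<in> (junior_simplex :: (real ^ 'n) set)"
      unfolding junior_simplex_def
      by (rule convex_sum) (use y in \<open>auto intro: hull_inc\<close>)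
    moreover have "(\<Sum>i\<in>UNIV. y $ i *\<^sub>R axis i 1) = y"
      by (simp add: vec_eq_iff axis_def if_distrib cong: if_cong)
    ultimately show "y \<in> junior_simplex" by simp
  qed
qed

section \<open>Diagonal matrices and the exponential map\<close>

lemma diag_mult: "diag a ** diag b = (diag (\<chi> i. a $ i * b $ i) :: 'a::semiring_1 ^ 'n ^ 'n)"
proof -
  have "(\<Sum>k\<in>UNIV. (if i = k then a $ i else 0) * (if k = j then b $ k else 0))
      = (\<Sum>k\<in>UNIV. if i = k then (if i = j then a $ i * b $ i else 0) else 0)" for i j
    by (rule sum.cong) auto
  then show ?thesis by (simp add: diag_def matrix_matrix_mult_def vec_eq_iff)
qed

lemma diag_eq_iff: "diag a = diag b \<longleftrightarrow> a = b"
proof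
  assume "diag a = diag b"
  then have "diag a $ i $ i = diag b $ i $ i" for i by simp
  then show "a = b" by (simp add: diag_def vec_eq_iff)
qed simp

text \<open>The exponential map onto the compact diagonal torus. It turns addition into matrix
  multiplication, and \<open>lattice_of G\<close> is the preimage of \<open>G\<close> under
  it.\<close>

definition exp_diag :: "real ^ 'n \<Rightarrow> complex ^ 'n ^ 'n" where
  "exp_diag y = diag (\<chi> i. exp (2 * of_real pi * \<i> * of_real (y $ i)))"

lemma mem_lattice_of: "y \<in> lattice_of G \<longleftrightarrow> exp_diag y \<in> G"
  by (simp add: lattice_of_def exp_diag_def)

lemma exp_diag_add: "exp_diag (x + y) = exp_diag x ** exp_diag y"
  by (simp add: exp_diag_def diag_mult algebra_simps exp_add)

lemma exp_diag_zero: "exp_diag 0 = mat 1"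
  by (simp add: exp_diag_def diag_def mat_def vec_eq_iff)

lemma exp_2pi_i_eq_imp:
  assumes "exp (2 * of_real pi * \<i> * of_real x) = exp (2 * of_real pi * \<i> * of_real y)"
  shows "x - y \<in> \<int>"
proof -
  obtain n :: int where "2 * of_real pi * \<i> * of_real x
      = 2 * of_real pi * \<i> * of_real y + of_int (2 * n) * of_real pi * \<i>"
    using assms unfolding exp_eq by auto
  then have "(2 * pi * \<i>) * complex_of_real x = (2 * pi * \<i>) * complex_of_real (y + of_int n)"
    by (simp add: algebra_simps)
  then have "complex_of_real x = complex_of_real (y + of_int n)"
    by (subst (asm) mult_left_cancel) auto
  then have "x = y + of_int n" by (simp only: of_real_eq_iff)
  then show ?thesis by simp
qed

lemma det_exp_diag:
  "det (exp_diag y) = exp (2 * of_real pi * \<i> * of_real (\<Sum>i\<in>UNIV. y $ i))"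
proof -
  have "det (exp_diag y) = (\<Prod>i\<in>UNIV. exp_diag y $ i $ i)"
    by (rule det_diagonal) (simp add: exp_diag_def diag_def)
  then show ?thesis
    by (simp add: exp_diag_def diag_def sum_distrib_left flip: exp_sum)
qed

section \<open>The lattice of a subgroup of \<open>SL\<close>\<close>

context
  fixes G :: "(complex ^ 'n ^ 'n) set"
  assumes G: "subgroup G SL"
begin

lemma lattice_of_zero: "0 \<in> lattice_of G"
  using subgroup.one_closed[OF G] by (simp add: mem_lattice_of exp_diag_zero SL_def)

lemma lattice_of_add: "x \<in> lattice_of G \<Longrightarrow> y \<in> lattice_of G \<Longrightarrow> x + y \<in> lattice_of G"
  using subgroup.m_closed[OF G] by (simp add: mem_lattice_of exp_diag_add SL_def)

lemma lattice_of_minus: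
  assumes "x \<in> lattice_of G" shows "- x \<in> lattice_of G"
proof -
  have x: "exp_diag x \<in> G" using assms by (simp add: mem_lattice_of)
  interpret group "SL :: (complex ^ 'n ^ 'n) monoid" by (rule group_SL)
  have carr: "exp_diag x \<in> carrier SL" using subgroup.mem_carrier[OF G x] .
  have "exp_diag (- x) ** exp_diag x = mat 1"
    using exp_diag_add[of "- x" x] by (simp add: exp_diag_zero)
  \<comment> \<open>Uniqueness of inverses in \<open>SL\<close> applies only to members of its
    carrier, hence the determinant is needed.\<close>
  moreover from this have "det (exp_diag (- x)) = 1"
    using det_mul[of "exp_diag (- x)" "exp_diag x"] carr by (simp add: SL_def)
  ultimately have "inv\<^bsub>SL\<^esub> (exp_diag x) = exp_diag (- x)"
    using carr by (intro inv_equality) (auto simp: SL_def)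
  then show ?thesis using subgroup.m_inv_closed[OF G x] by (simp add: mem_lattice_of)
qed

lemma lattice_of_diff: "x \<in> lattice_of G \<Longrightarrow> y \<in> lattice_of G \<Longrightarrow> x - y \<in> lattice_of G"
  using lattice_of_add[of x "- y"] lattice_of_minus[of y] by simp

text \<open>The determinant of \<open>exp_diag y\<close> is the exponential of
  \<open>2 * pi * \<i>\<close> times the coordinate sum, and it equals 1 in
  \<open>SL\<close>.\<close>

lemma sum_lattice_of_Ints:
  assumes "y \<in> lattice_of G" shows "(\<Sum>i\<in>UNIV. y $ i) \<in> \<int>"
proof -
  have "det (exp_diag y) = 1"
    using assms subgroup.mem_carrier[OF G] by (auto simp: mem_lattice_of SL_def)
  then show ?thesis
    unfolding det_exp_diag using exp_2pi_i_eq_imp[of "\<Sum>i\<in>UNIV. y $ i" 0] by simp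
qed

lemma sum_lattice_of_orthant_ge_1:
  assumes "y \<in> lattice_of G" "y \<in> positive_orthant" "y \<noteq> 0"
  shows "(\<Sum>i\<in>UNIV. y $ i) \<ge> 1"
proof -
  have nn: "\<forall>i. 0 \<le> y $ i" using assms by (simp add: positive_orthant_eq)
  have "(\<Sum>i\<in>UNIV. y $ i) \<noteq> 0"
    using assms(3) nn by (subst sum_nonneg_eq_0_iff) (auto simp: vec_eq_iff)
  moreover have "(\<Sum>i\<in>UNIV. y $ i) \<ge> 0" using nn by (simp add: sum_nonneg)
  ultimately show ?thesis using sum_lattice_of_Ints[OF assms(1)] by (auto elim!: Ints_cases)
qed

text \<open>Pigeonhole: the multiples of \<open>y\<close> by naturals all map into the finite
  \<open>G\<close>, so two distinct multiples have the same image and differ by an integral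
  vector.\<close>

lemma lattice_of_Rats:
  assumes "finite G" "y \<in> lattice_of G" shows "y $ i \<in> \<rat>"
proof -
  have mult: "real k *\<^sub>R y \<in> lattice_of G" for k
    by (induction k) (auto simp: lattice_of_zero algebra_simps lattice_of_add assms)
  have "finite (range (\<lambda>k::nat. exp_diag (real k *\<^sub>R y)))"
    by (rule finite_subset[OF _ assms(1)]) (use mult in \<open>auto simp: mem_lattice_of\<close>)
  then have "\<not> inj (\<lambda>k::nat. exp_diag (real k *\<^sub>R y))"
    using finite_imageD infinite_UNIV_nat by blast
  then obtain k l :: nat where kl: "k \<noteq> l" "exp_diag (real k *\<^sub>R y) = exp_diag (real l *\<^sub>R y)"
    by (auto simp: inj_def)
  from kl(2) have "exp (2 * of_real pi * \<i> * of_real (real k * y $ i))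
      = exp (2 * of_real pi * \<i> * of_real (real l * y $ i))"
    unfolding exp_diag_def diag_eq_iff by (simp add: vec_eq_iff)
  then have "real k * y $ i - real l * y $ i \<in> \<int>" by (rule exp_2pi_i_eq_imp)
  then have "(real k * y $ i - real l * y $ i) / (real k - real l) \<in> \<rat>"
    using Ints_subset_Rats by (intro Rats_divide) auto
  then show ?thesis using kl(1) by (simp flip: left_diff_distrib)
qed

section \<open>The two inclusions\<close>

text \<open>Both parts of a splitting would have coordinate sum at least 1, hence at least 2
  together, whereas points of the junior simplex have coordinate sum 1.\<close>

lemma hilbert_basis_superset:
  "junior_simplex \<inter> lattice_of G \<subseteq> hilbert_basis (lattice_of G) positive_orthant"
proof clarify
  fix n assume n: "n \<in> junior_simplex" "n \<in> lattice_of G"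
  have "n \<noteq> a + b" if "a \<in> positive_orthant \<inter> (lattice_of G - {0})"
    "b \<in> positive_orthant \<inter> (lattice_of G - {0})" for a b
    using sum_lattice_of_orthant_ge_1[of a] sum_lattice_of_orthant_ge_1[of b] that n
    by (auto simp: junior_simplex_eq sum.distrib)
  then show "n \<in> hilbert_basis (lattice_of G) positive_orthant"
    using n by (auto simp: hilbert_basis_def junior_simplex_eq positive_orthant_eq)
qed

text \<open>The difference \<open>n - v\<close> may be 0; this is exactly the case that remains when
  \<open>n\<close> is in the Hilbert basis.\<close>

lemma split_off_junior_lattice_point:
  assumes fin: "finite G" and T: "basic_triangulation (lattice_of G) junior_simplex \<T>"
    and n: "n \<in> lattice_of G" "n \<in> positive_orthant" "n \<noteq> 0"
  obtains v where "v \<in> junior_simplex \<inter> lattice_of G" "n - v \<in> positive_orthant"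
proof -
  define s where "s = (\<Sum>i\<in>UNIV. n $ i)"
  have s: "s \<ge> 1" unfolding s_def by (rule sum_lattice_of_orthant_ge_1[OF n])
  \<comment> \<open>Dividing by the coordinate sum moves \<open>n\<close> along its ray to the
    hyperplane of the junior simplex.\<close>
  have "(1 / s) *\<^sub>R n \<in> junior_simplex"
    using n s by (auto simp: junior_simplex_eq positive_orthant_eq s_def simp flip: sum_divide_distrib)
  then obtain S where S: "S \<in> \<T>" "(1 / s) *\<^sub>R n \<in> S"
    using T unfolding basic_triangulation_def lattice_triangulation_def by (metis UnionE)
  have "basic_simplex (lattice_of G) S" and SJ: "S \<subseteq> junior_simplex"
    and vert: "vertices S \<subseteq> lattice_of G"
    using T S(1) by (auto simp: basic_triangulation_def lattice_triangulation_def)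
  then obtain d B where d: "d simplex S" and B: "int_basis B (lattice_of G)" "vertices S \<subseteq> B"
    by (auto simp: basic_simplex_def)
  obtain C where C: "\<not> affine_dependent C" "S = convex hull C"
    using d by (auto simp: simplex_def)
  have finC: "finite C" using C(1) by (rule aff_independent_finite)
  \<comment> \<open>Affine independence makes every point of \<open>C\<close> extreme, so basicness,
    which speaks of extreme points, applies to \<open>C\<close>.\<close>
  have vC: "vertices S = C"
    by (simp add: vertices_def C(2) extreme_point_of_convex_hull_affine_independent[OF C(1)])
  have CJ: "C \<subseteq> junior_simplex" using SJ C(2) hull_subset[of C convex] by simp
  have "B \<subseteq> lattice_of G"
    using B(1) module.span_superset[OF module_int_scale, of B] by (simp add: int_basis_def)
  then have ind: "independent B"
    using B(1) lattice_of_Rats[OF fin] by (intro independent_if_int_independent) (auto simp: int_basis_def)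
  obtain u where u: "\<forall>v\<in>C. 0 \<le> u v" "sum u C = 1" "(\<Sum>v\<in>C. u v *\<^sub>R v) = (1 / s) *\<^sub>R n"
    using S(2) unfolding C(2) convex_hull_finite[OF finC] by blast
  have eq: "(\<Sum>v\<in>C. (s * u v) *\<^sub>R v) = n"
    using arg_cong[OF u(3), of "\<lambda>x. s *\<^sub>R x"] s by (simp add: scaleR_sum_right)
  obtain v where v: "v \<in> C" "u v \<noteq> 0"
    using u(2) by (metis sum.neutral zero_neq_one)
  have "s * u v \<in> \<int>"
    using int_coefficients_if_int_basis[OF B(1) ind finC] B(2) vC eq n(1) v(1) by auto
  moreover have "s * u v > 0" using u(1) v s by (simp add: less_le)
  \<comment> \<open>A positive integer coefficient is at least 1, so a whole copy of
    \<open>v\<close> can be removed.\<close>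
  ultimately have ge1: "s * u v \<ge> 1" by (auto elim!: Ints_cases)
  \<comment> \<open>All summands of \<open>n\<close> over \<open>C\<close> have nonnegative
    coordinates, so the single summand at \<open>v\<close> is bounded by \<open>n\<close>.\<close>
  have "v $ i \<le> n $ i" for i
  proof -
    have nn: "0 \<le> w $ i" if "w \<in> C" for w using CJ that by (auto simp: junior_simplex_eq)
    have "v $ i \<le> (s * u v) * v $ i" using mult_right_mono[OF ge1 nn[OF v(1)]] by simp
    also have "\<dots> \<le> (\<Sum>w\<in>C. (s * u w) * w $ i)"
      by (rule member_le_sum[OF v(1)]) (use u(1) s nn finC in auto)
    also have "\<dots> = n $ i" using arg_cong[OF eq, of "\<lambda>x. x $ i"] by simp
    finally show ?thesis .
  qed
  then show thesis using that[of v] v CJ vert vC by (auto simp: positive_orthant_eq)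
qed

lemma hilbert_basis_subset:
  assumes fin: "finite G" and T: "basic_triangulation (lattice_of G) junior_simplex \<T>"
  shows "hilbert_basis (lattice_of G) positive_orthant \<subseteq> junior_simplex \<inter> lattice_of G"
proof
  fix n assume n: "n \<in> hilbert_basis (lattice_of G) positive_orthant"
  then obtain v where v: "v \<in> junior_simplex \<inter> lattice_of G" and nv: "n - v \<in> positive_orthant"
    using split_off_junior_lattice_point[OF fin T, of n] by (auto simp: hilbert_basis_def)
  have v': "v \<in> positive_orthant \<inter> (lattice_of G - {0})"
    using v by (auto simp: junior_simplex_eq positive_orthant_eq)
  have "n - v \<in> lattice_of G" using n v lattice_of_diff by (auto simp: hilbert_basis_def)
  moreover have "n = v + (n - v)" by simp
  \<comment> \<open>Otherwise \<open>v\<close> and \<open>n - v\<close> would be nonzero lattice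
    points of the orthant with sum \<open>n\<close>, which is excluded.\<close>
  ultimately have "n - v = 0" using n v' nv unfolding hilbert_basis_def by blast
  then show "n \<in> junior_simplex \<inter> lattice_of G" using v by simp
qed

end

theorem theorem6p1:
  fixes G :: "(complex ^ 'n ^ 'n) set"
  assumes "CARD('n) \<ge> 2"
    and "subgroup G SL"
    and "finite G"
    and "comm_group (SL\<lparr>carrier := G\<rparr>)"
    and "\<forall>A\<in>G. \<exists>d. A = diag d"
    and "\<exists>\<T>. basic_triangulation (lattice_of G) junior_simplex \<T>"
  shows "hilbert_basis (lattice_of G) positive_orthant = junior_simplex \<inter> lattice_of G"
  using assms hilbert_basis_subset hilbert_basis_superset by blast

end
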